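(* For $n\ge 2$, let $T_n=\{A\in\mathbb{C}^{n\times n}:\ \|A-\tfrac34 I_n\|_{\rm max}\le \tfrac14\}$. No matrix in $T_n$ is $\mathcal U$-apportionable.
   Context: For a matrix $B=[b_{kj}]$, $\|B\|_{\rm max}=\max_{k,j}|b_{kj}|$. A complex square matrix $B=[b_{kj}]$ is uniform if there is a real number $c\ge 0$ with $|b_{kj}|=c$ for all $k,j$. A matrix $A\in\mathbb{C}^{n\times n}$ is $\mathcal U$-apportionable if there is an $n\times n$ unitary matrix $U$ such that $UAU^*$ is uniform. *)

theory Defs
  imports "Jordan_Normal_Form.Schur_Decomposition" "Jordan_Normal_Form.Conjugate"
begin

text \<open>Only meaningful for matrices with at least one entry (\<open>Max\<close> of the empty set is
  unspecified).\<close>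

definition max_norm_mat :: "complex mat \<Rightarrow> real" where
  "max_norm_mat B = Max (cmod ` elements_mat B)"

definition uniform_mat :: "complex mat \<Rightarrow> bool" where
  "uniform_mat B \<longleftrightarrow> square_mat B \<and>
     (\<exists>c::real. c \<ge> 0 \<and> (\<forall>k < dim_row B. \<forall>j < dim_col B. cmod (B $$ (k, j)) = c))"

definition unitary_mat :: "complex mat \<Rightarrow> bool" where
  "unitary_mat U \<longleftrightarrow> square_mat U \<and>
     inverts_mat U (mat_adjoint U) \<and> inverts_mat (mat_adjoint U) U"

text \<open>Intended for square \<open>A\<close>; the order of \<open>U\<close> is that of \<open>A\<close>.\<close>

definition U_apportionable :: "complex mat \<Rightarrow> bool" where
  "U_apportionable A \<longleftrightarrow>
     (\<exists>U \<in> carrier_mat (dim_row A) (dim_row A).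
        unitary_mat U \<and> uniform_mat (U * A * mat_adjoint U))"

definition T :: "nat \<Rightarrow> complex mat set" where
  "T n = {A \<in> carrier_mat n n. max_norm_mat (A - (3/4) \<cdot>\<^sub>m 1\<^sub>m n) \<le> 1/4}"

end

theory Submission
  imports Defs
begin

text \<open>Trace and Frobenius norm are invariant under unitary similarity, and a uniform \<open>n \<times> n\<close>
  matrix with entries of modulus \<open>c\<close> satisfies \<open>\<bar>tr B\<bar>\<^sup>2 \<le> n\<^sup>2 c\<^sup>2 = \<parallel>B\<parallel>\<^sub>F\<^sup>2\<close>. For \<open>A \<in> T n\<close> the
  inequality is reversed strictly: \<open>\<bar>tr A\<bar>\<^sup>2\<close> is the sum of all \<open>Re (a\<^sub>i\<^sub>i cnj a\<^sub>j\<^sub>j)\<close>, which for \<open>i \<noteq> j\<close>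
  is at least \<open>1/4 - 1/16\<close>, whereas \<open>\<bar>a\<^sub>i\<^sub>j\<bar>\<^sup>2 \<le> 1/16\<close>.\<close>

definition mat_trace :: "'a :: comm_monoid_add mat \<Rightarrow> 'a" where
  "mat_trace A = (\<Sum>i<dim_row A. A $$ (i, i))"

lemma mat_trace_mult_comm:
  fixes A B :: "'a :: comm_semiring_0 mat"
  assumes "A \<in> carrier_mat n m" "B \<in> carrier_mat m n"
  shows "mat_trace (A * B) = mat_trace (B * A)"
proof -
  have "mat_trace (A * B) = (\<Sum>i<n. \<Sum>j<m. A $$ (i, j) * B $$ (j, i))"
    using assms by (auto simp: mat_trace_def scalar_prod_def atLeast0LessThan intro!: sum.cong)
  also have "\<dots> = (\<Sum>j<m. \<Sum>i<n. B $$ (j, i) * A $$ (i, j))"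
    by (subst sum.swap) (simp add: mult.commute)
  also have "\<dots> = mat_trace (B * A)"
    using assms by (auto simp: mat_trace_def scalar_prod_def atLeast0LessThan intro!: sum.cong)
  finally show ?thesis .
qed

lemma mat_adjoint_carrier [simp]:
  "A \<in> carrier_mat n m \<Longrightarrow> mat_adjoint A \<in> carrier_mat m n"
  by (auto simp: mat_adjoint_def)

lemma dim_mat_adjoint [simp]:
  "dim_row (mat_adjoint A) = dim_col A" "dim_col (mat_adjoint A) = dim_row A"
  by (auto simp: mat_adjoint_def)

lemma index_mat_adjoint:
  "A \<in> carrier_mat n m \<Longrightarrow> i < m \<Longrightarrow> j < n \<Longrightarrow> mat_adjoint A $$ (i, j) = conjugate (A $$ (j, i))"
  by (auto simp: mat_adjoint_def mat_of_rows_index)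

lemma mat_adjoint_mult:
  fixes A B :: "complex mat"
  assumes "A \<in> carrier_mat n m" "B \<in> carrier_mat m l"
  shows "mat_adjoint (A * B) = mat_adjoint B * mat_adjoint A"
proof (rule eq_matI)
  note AB = mult_carrier_mat[OF assms]
  fix i j assume "i < dim_row (mat_adjoint B * mat_adjoint A)"
    "j < dim_col (mat_adjoint B * mat_adjoint A)"
  then have ij: "i < l" "j < n"
    using assms by auto
  have "mat_adjoint (A * B) $$ (i, j) = cnj (\<Sum>k = 0..<m. A $$ (j, k) * B $$ (k, i))"
    using assms ij by (simp add: index_mat_adjoint[OF AB] scalar_prod_def)
  also have "\<dots> = (\<Sum>k = 0..<m. mat_adjoint B $$ (i, k) * mat_adjoint A $$ (k, j))"
    using ij by (simp add: index_mat_adjoint[OF assms(1)] index_mat_adjoint[OF assms(2)] mult.commute)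
  also have "\<dots> = (mat_adjoint B * mat_adjoint A) $$ (i, j)"
    using assms ij by (simp add: scalar_prod_def)
  finally show "mat_adjoint (A * B) $$ (i, j) = (mat_adjoint B * mat_adjoint A) $$ (i, j)" .
qed (use assms in \<open>auto simp: mat_adjoint_def\<close>)

lemma mat_adjoint_adjoint [simp]: "mat_adjoint (mat_adjoint A) = (A :: complex mat)"
proof (rule eq_matI)
  have A: "A \<in> carrier_mat (dim_row A) (dim_col A)" by simp
  show "mat_adjoint (mat_adjoint A) $$ (i, j) = A $$ (i, j)"
    if "i < dim_row A" "j < dim_col A" for i j
    using that by (simp add: index_mat_adjoint[OF mat_adjoint_carrier[OF A]] index_mat_adjoint[OF A])
qed (auto simp: mat_adjoint_def)

text \<open>The i-th diagonal entry of the product is the squared length of row i. This writes the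
  squared Frobenius norm as a trace, so that cyclicity applies to it.\<close>

lemma mat_trace_mult_adjoint:
  fixes A :: "complex mat"
  assumes "A \<in> carrier_mat n m"
  shows "mat_trace (A * mat_adjoint A) = of_real (\<Sum>i<n. \<Sum>j<m. (cmod (A $$ (i, j)))\<^sup>2)"
  unfolding mat_trace_def of_real_sum
  using assms
  by (auto simp: scalar_prod_def atLeast0LessThan index_mat_adjoint[OF assms] complex_norm_square
      intro!: sum.cong simp del: of_real_power)

context
  fixes n :: nat and U A :: "complex mat"
  assumes U: "U \<in> carrier_mat n n" and A: "A \<in> carrier_mat n n" and unitary: "unitary_mat U"
begin

private lemma adjoint_mult_self: "mat_adjoint U * U = 1\<^sub>m n"
  using unitary mat_adjoint_carrier[OF U] by (auto simp: unitary_mat_def inverts_mat_def)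

text \<open>Cyclicity moves \<open>mat_adjoint U\<close> to the front, where it cancels against
  \<open>U\<close>.\<close>

lemma mat_trace_unitary_similar: "mat_trace (U * A * mat_adjoint U) = mat_trace A"
proof -
  note V = mat_adjoint_carrier[OF U]
  have "mat_trace (U * A * mat_adjoint U) = mat_trace (mat_adjoint U * (U * A))"
    using U A V by (intro mat_trace_mult_comm) auto
  also have "mat_adjoint U * (U * A) = (mat_adjoint U * U) * A"
    using assoc_mult_mat[OF V U A] by simp
  finally show ?thesis
    using A by (simp add: adjoint_mult_self)
qed

lemma frobenius_norm_unitary_similar:
  "(\<Sum>i<n. \<Sum>j<n. (cmod ((U * A * mat_adjoint U) $$ (i, j)))\<^sup>2)
    = (\<Sum>i<n. \<Sum>j<n. (cmod (A $$ (i, j)))\<^sup>2)"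
proof -
  define V where "V = mat_adjoint U"
  define W where "W = mat_adjoint A"
  have V: "V \<in> carrier_mat n n" and W: "W \<in> carrier_mat n n"
    using U A by (auto simp: V_def W_def)
  have VU: "V * U = 1\<^sub>m n"
    using adjoint_mult_self by (simp add: V_def)
  have UA: "U * A \<in> carrier_mat n n" and UAV: "U * A * V \<in> carrier_mat n n"
    using U A V by auto
  have "mat_adjoint (U * A * V) = U * (W * V)"
    using mat_adjoint_mult[OF UA V] mat_adjoint_mult[OF U A] by (simp add: V_def W_def)
  then have "mat_trace (U * A * V * mat_adjoint (U * A * V)) = mat_trace (U * A * V * (U * (W * V)))"
    by simp
  \<comment> \<open>Exchanging the two factors leaves \<open>V * U = 1\<close> between
    \<open>W\<close> and \<open>A\<close>; one more cyclic move brings the outer \<open>V\<close>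
    and \<open>U\<close> together.\<close>
  also have "\<dots> = mat_trace (U * (W * V) * (U * A * V))"
    using U V W UAV by (intro mat_trace_mult_comm) auto
  also have "U * (W * V) * (U * A * V) = U * (W * (V * U) * A * V)"
    using U A V W by (simp add: assoc_mult_mat[of _ n n _ n _ n])
  also have "mat_trace \<dots> = mat_trace (W * A * V * U)"
    using U A V W VU by (subst mat_trace_mult_comm[of _ n n]) auto
  also have "W * A * V * U = W * A * (V * U)"
    using U A V W by (simp add: assoc_mult_mat[of _ n n _ n _ n])
  also have "mat_trace \<dots> = mat_trace (A * W)"
    using A W VU by (subst mat_trace_mult_comm[of A n n]) auto
  \<comment> \<open>Both traces are \<open>of_real\<close> of the real sums in question, and
    \<open>of_real\<close> is injective.\<close>
  finally show ?thesis
    using mat_trace_mult_adjoint[OF UAV] mat_trace_mult_adjoint[OF A]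
    unfolding V_def W_def of_real_eq_iff by (metis of_real_eq_iff)
qed

end

lemma uniform_mat_trace_le_frobenius:
  assumes "B \<in> carrier_mat n n" "uniform_mat B"
  shows "(cmod (mat_trace B))\<^sup>2 \<le> (\<Sum>i<n. \<Sum>j<n. (cmod (B $$ (i, j)))\<^sup>2)"
proof -
  obtain c where c: "c \<ge> 0" "\<And>i j. i < n \<Longrightarrow> j < n \<Longrightarrow> cmod (B $$ (i, j)) = c"
    using assms unfolding uniform_mat_def by auto
  have "cmod (mat_trace B) \<le> (\<Sum>i<n. cmod (B $$ (i, i)))"
    using assms by (auto simp: mat_trace_def intro: norm_sum)
  also have "\<dots> = n * c"
    using c by simp
  finally have "(cmod (mat_trace B))\<^sup>2 \<le> (n * c)\<^sup>2"
    by (intro power_mono) auto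
  also have "\<dots> = (\<Sum>i<n. \<Sum>j<n. (cmod (B $$ (i, j)))\<^sup>2)"
    using c by (simp add: power2_eq_square)
  finally show ?thesis .
qed

lemma cmod_le_max_norm_mat:
  assumes "B \<in> carrier_mat n m" "i < n" "j < m"
  shows "cmod (B $$ (i, j)) \<le> max_norm_mat B"
  unfolding max_norm_mat_def
  using assms by (intro Max_ge imageI elements_matI[of _ n m]) (auto simp: elements_mat_def)

text \<open>Expand z times its conjugate and take real parts. With \<open>d\<close> the diagonal of
  a matrix, the result is indexed like the Frobenius sum, so the two can be compared term by
  term.\<close>

lemma cmod_sum_power2: "(cmod (\<Sum>i\<in>I. d i))\<^sup>2 = (\<Sum>i\<in>I. \<Sum>j\<in>I. Re (d i * cnj (d j)))"
proof -
  have "complex_of_real ((cmod (\<Sum>i\<in>I. d i))\<^sup>2) = (\<Sum>i\<in>I. \<Sum>j\<in>I. d i * cnj (d j))"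
    unfolding complex_norm_square by (simp add: sum_product)
  then show ?thesis
    by (metis (no_types, lifting) Re_complex_of_real Re_sum sum.cong)
qed

text \<open>The real part is \<open>Re x * Re y + Im x * Im y\<close>. Enclosing the disc in a box
  bounds the first product below by 1/4 and the second by -1/16; this crude bound is enough, as only
  1/16 has to be beaten.\<close>

lemma Re_mult_cnj_ge:
  assumes "cmod (x - 3/4) \<le> 1/4" "cmod (y - 3/4) \<le> 1/4"
  shows "Re (x * cnj y) \<ge> 3/16"
proof -
  have "Re x \<ge> 1/2" "Re y \<ge> 1/2" "\<bar>Im x\<bar> \<le> 1/4" "\<bar>Im y\<bar> \<le> 1/4"
    using assms abs_Re_le_cmod[of "x - 3/4"] abs_Re_le_cmod[of "y - 3/4"]
      abs_Im_le_cmod[of "x - 3/4"] abs_Im_le_cmod[of "y - 3/4"] by auto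
  then have "1/2 * (1/2) \<le> Re x * Re y" "\<bar>Im x\<bar> * \<bar>Im y\<bar> \<le> 1/4 * (1/4)"
    by - (rule mult_mono; simp)+
  moreover have "- (\<bar>Im x\<bar> * \<bar>Im y\<bar>) \<le> Im x * Im y"
    by (metis abs_mult abs_ge_minus_self minus_le_iff)
  ultimately show ?thesis
    by simp
qed

lemma T_frobenius_less_trace:
  assumes "n \<ge> 2" "A \<in> T n"
  shows "(\<Sum>i<n. \<Sum>j<n. (cmod (A $$ (i, j)))\<^sup>2) < (cmod (mat_trace A))\<^sup>2"
proof -
  \<comment> \<open>As functions of pairs, both double sums become sums over one finite set, where
    \<open>f \<le> g\<close> together with a single strict pair gives strict inequality.\<close>
  define f where "f = (\<lambda>(i, j). (cmod (A $$ (i, j)))\<^sup>2)"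
  define g where "g = (\<lambda>(i, j). Re (A $$ (i, i) * cnj (A $$ (j, j))))"
  have A: "A \<in> carrier_mat n n"
    and "max_norm_mat (A - (3/4) \<cdot>\<^sub>m 1\<^sub>m n) \<le> 1/4"
    using assms by (auto simp: T_def)
  then have bound: "cmod ((A - (3/4) \<cdot>\<^sub>m 1\<^sub>m n) $$ (i, j)) \<le> 1/4" if "i < n" "j < n" for i j
    using cmod_le_max_norm_mat[of "A - (3/4) \<cdot>\<^sub>m 1\<^sub>m n" n n i j] that by fastforce
  have diag: "cmod (A $$ (i, i) - 3/4) \<le> 1/4" if "i < n" for i
    using bound[OF that that] A that by simp
  \<comment> \<open>Off the diagonal the shift by 3/4 vanishes, so \<open>bound\<close> limits the
    entry itself: \<open>f\<close> is at most 1/16, \<open>g\<close> at least 3/16.\<close>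
  have less: "f (i, j) < g (i, j)" if "i < n" "j < n" "i \<noteq> j" for i j
  proof -
    have "(cmod (A $$ (i, j)))\<^sup>2 \<le> (1/4)\<^sup>2"
      using bound[of i j] A that by (intro power_mono) auto
    then show ?thesis
      using Re_mult_cnj_ge[OF diag[of i] diag[of j]] that by (simp add: f_def g_def power2_eq_square)
  qed
  \<comment> \<open>On the diagonal there is no gain, so strictness must come from an off-diagonal
    pair.\<close>
  have eq: "f (i, i) = g (i, i)" for i
    by (simp add: f_def g_def cmod_power2 flip: power2_eq_square)
  have le: "\<forall>p \<in> {..<n} \<times> {..<n}. f p \<le> g p"
    using less eq by (fastforce intro: less_imp_le)
  have "sum f ({..<n} \<times> {..<n}) < sum g ({..<n} \<times> {..<n})"
  proof (rule sum_strict_mono_ex1)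
    \<comment> \<open>The pair (0, 1) is available because \<open>n \<ge> 2\<close>; for n = 1 the
      two sums coincide.\<close>
    show "\<exists>p \<in> {..<n} \<times> {..<n}. f p < g p"
      using assms(1) less[of 0 1] by (intro bexI[of _ "(0, 1)"]) auto
  qed (use le in auto)
  then show ?thesis
    using A by (simp add: f_def g_def mat_trace_def cmod_sum_power2 sum.cartesian_product
        del: times_complex.sel)
qed

theorem proposition3p2:
  fixes n :: nat
  assumes "n \<ge> 2"
  shows "\<forall>A \<in> T n. \<not> U_apportionable A"
proof (intro ballI notI)
  fix A assume "A \<in> T n" "U_apportionable A"
  then have A: "A \<in> carrier_mat n n"
    by (simp add: T_def)
  with \<open>U_apportionable A\<close> obtain U
    where U: "U \<in> carrier_mat n n" "unitary_mat U" "uniform_mat (U * A * mat_adjoint U)"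
    by (auto simp: U_apportionable_def)
  have "U * A * mat_adjoint U \<in> carrier_mat n n"
    using U A by (meson mat_adjoint_carrier mult_carrier_mat)
  \<comment> \<open>The inequality for the uniform matrix carries over to \<open>A\<close> by the
    two invariances.\<close>
  from uniform_mat_trace_le_frobenius[OF this U(3)]
  have "(cmod (mat_trace A))\<^sup>2 \<le> (\<Sum>i<n. \<Sum>j<n. (cmod (A $$ (i, j)))\<^sup>2)"
    using mat_trace_unitary_similar[OF U(1) A U(2)] frobenius_norm_unitary_similar[OF U(1) A U(2)]
    by simp
  then show False
    using T_frobenius_less_trace[OF assms \<open>A \<in> T n\<close>] by simp
qed

end
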